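(* Let $m\ge 2$ be an integer and let $\omega=\omega_m$ be the $m$-th multinacci number. Then the invariant set $\mathcal{S}_\omega$ is totally self-similar, i.e. $$f_{\boldsymbol\varepsilon}(\mathcal{S}_\omega)=f_{\boldsymbol\varepsilon}(\Delta)\cap\mathcal{S}_\omega\quad\text{for every } n\ge 1 \text{ and every } \boldsymbol\varepsilon\in\Sigma^n,$$ where the maps $f_i$ are taken with contraction factor $\lambda=\omega_m$.
   Context: Let $\mathbf p_k=\frac23(\cos(2\pi k/3),\sin(2\pi k/3))\in\mathbb{R}^2$, $k=0,1,2$, and let $\Delta$ be the closed (filled) equilateral triangle with vertices $\mathbf p_0,\mathbf p_1,\mathbf p_2$. For $\lambda\in(0,1)$ let $f_i(\mathbf x)=\lambda\mathbf x+(1-\lambda)\mathbf p_i$, $i=0,1,2$. The invariant set $\mathcal{S}_\lambda$ is the unique non-empty compact set with $\mathcal{S}_\lambda=\bigcup_{i=0}^2 f_i(\mathcal{S}_\lambda)$. Put $\Sigma=\{0,1,2\}$ and, for $\boldsymbol\varepsilon=(\varepsilon_0,\dots,\varepsilon_{n-1})\in\Sigma^n$, $f_{\boldsymbol\varepsilon}=f_{\varepsilon_0}\circ\cdots\circ f_{\varepsilon_{n-1}}$. For $m\ge2$ the multinacci number $\omega_m$ is the unique positive root of $x^m+x^{m-1}+\cdots+x=1$. *)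

theory Defs
  imports "HOL-Analysis.Analysis"
begin

definition vert :: "nat \<Rightarrow> real ^ 2" where
  "vert k = (2 / 3) *\<^sub>R vector [cos (2 * pi * real k / 3), sin (2 * pi * real k / 3)]"

definition triangle :: "(real ^ 2) set" where
  "triangle = convex hull {vert 0, vert 1, vert 2}"

definition sim_map :: "real \<Rightarrow> nat \<Rightarrow> real ^ 2 \<Rightarrow> real ^ 2" where
  "sim_map l i x = l *\<^sub>R x + (1 - l) *\<^sub>R vert i"

definition digits :: "nat set" where
  "digits = {0, 1, 2}"

definition is_invariant_set :: "real \<Rightarrow> (real ^ 2) set \<Rightarrow> bool" where
  "is_invariant_set l S \<longleftrightarrow>
     S \<noteq> {} \<and> compact S \<and> S = (\<Union>i\<in>digits. sim_map l i ` S)"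

text \<open>The definite description is meaningful for \<open>0 < l < 1\<close>; see
  \<open>ex1_invariant_set\<close> below.\<close>

definition invariant_set :: "real \<Rightarrow> (real ^ 2) set" where
  "invariant_set l = (THE S. is_invariant_set l S)"

text \<open>A word is a list, leftmost letter outermost:
  \<open>word_map l [e0, e1, e2] = sim_map l e0 \<circ> sim_map l e1 \<circ> sim_map l e2\<close>.\<close>

definition word_map :: "real \<Rightarrow> nat list \<Rightarrow> real ^ 2 \<Rightarrow> real ^ 2" where
  "word_map l eps = foldr (\<lambda>i g. sim_map l i \<circ> g) eps id"

definition totally_self_similar :: "real \<Rightarrow> bool" where
  "totally_self_similar l \<longleftrightarrow>
     (\<forall>n\<ge>1. \<forall>eps. length eps = n \<and> set eps \<subseteq> digits \<longrightarrow>
        word_map l eps ` invariant_set l = word_map l eps ` triangle \<inter> invariant_set l)"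

text \<open>The definite description is meaningful for \<open>m \<ge> 1\<close>; see
  \<open>ex1_multinacci\<close> below.\<close>

definition multinacci :: "nat \<Rightarrow> real" where
  "multinacci m = (THE x. x > 0 \<and> (\<Sum>j = 1..m. x ^ j) = 1)"

lemma ex1_multinacci:
  assumes "m \<ge> 1"
  shows "\<exists>!x::real. x > 0 \<and> (\<Sum>j = 1..m. x ^ j) = 1"
proof -
  let ?g = "\<lambda>x::real. \<Sum>j = 1..m. x ^ j"
  have mono: "?g x < ?g y" if "0 \<le> x" "x < y" for x y
    using that assms by (intro sum_strict_mono) (auto intro: power_strict_mono)
  have "?g 0 \<le> 1" by (simp add: power_0_left)
  moreover have "1 \<le> ?g 1" using assms by simp
  moreover have "continuous_on {0..1} ?g" by (intro continuous_intros)
  ultimately obtain x where x: "0 \<le> x" "?g x = 1"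
    using IVT'[of ?g 0 1 1] by auto
  have "x \<noteq> 0"
  proof
    assume "x = 0"
    then have "?g x = 0" by (intro sum.neutral) auto
    with x show False by simp
  qed
  then have "x > 0 \<and> ?g x = 1" using x by simp
  moreover have "y = x" if "y > 0 \<and> ?g y = 1" for y
    using mono[of x y] mono[of y x] that x by (cases y x rule: linorder_cases) auto
  ultimately show ?thesis by blast
qed

lemma dist_sim_map:
  assumes "0 < l"
  shows "dist (sim_map l i x) (sim_map l i y) = l * dist x y"
proof -
  have "sim_map l i x - sim_map l i y = l *\<^sub>R (x - y)"
    by (simp add: sim_map_def algebra_simps)
  then show ?thesis using assms by (simp add: dist_norm)
qed

lemma inj_sim_map: "0 < l \<Longrightarrow> inj (sim_map l i)"
  by (auto simp: inj_def sim_map_def)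

lemma sim_map_triangle:
  assumes "0 < l" "l < 1" "i \<in> digits"
  shows "sim_map l i ` triangle \<subseteq> triangle"
proof -
  have "vert i \<in> triangle"
    using assms(3) by (auto simp: triangle_def digits_def intro: hull_inc)
  moreover have "convex triangle" by (simp add: triangle_def)
  ultimately show ?thesis
    using assms by (auto simp: sim_map_def intro!: convexD)
qed

lemma invariant_set_le:
  assumes l: "0 < l" "l < 1"
    and A: "is_invariant_set l A" and B: "is_invariant_set l B"
  shows "A \<subseteq> B"
proof -
  have A': "A \<noteq> {}" "compact A" "A = (\<Union>i\<in>digits. sim_map l i ` A)"
    using A by (auto simp: is_invariant_set_def)
  have B': "B \<noteq> {}" "compact B" "B = (\<Union>i\<in>digits. sim_map l i ` B)"
    using B by (auto simp: is_invariant_set_def)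
  have "continuous_on A (\<lambda>x. infdist x B)" by (intro continuous_intros)
  then obtain a where a: "a \<in> A" "\<And>x. x \<in> A \<Longrightarrow> infdist x B \<le> infdist a B"
    using continuous_attains_sup[OF A'(2,1), of "\<lambda>x. infdist x B"] by blast
  obtain i x where ix: "i \<in> digits" "x \<in> A" "a = sim_map l i x"
    using a(1) A'(3) by blast
  obtain b where b: "b \<in> B" "infdist x B = dist x b"
    using infdist_attains_inf[OF compact_imp_closed[OF B'(2)] B'(1)] by metis
  have "sim_map l i b \<in> B" using b(1) ix(1) B'(3) by blast
  then have "infdist a B \<le> l * infdist x B"
    using infdist_le[of "sim_map l i b" B a] dist_sim_map[OF l(1)] ix(3) b(2) by simp
  also have "\<dots> \<le> l * infdist a B" using a(2)[OF ix(2)] l by simp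
  finally have "(1 - l) * infdist a B \<le> 0" by (simp add: algebra_simps)
  then have "infdist a B \<le> 0" using l by (simp add: mult_le_0_iff)
  then have "infdist x B = 0" if "x \<in> A" for x
    using a(2)[OF that] infdist_nonneg[of x B] by linarith
  then show ?thesis
    using in_closed_iff_infdist_zero[OF compact_imp_closed[OF B'(2)] B'(1)] by blast
qed

lemma ex_invariant_set:
  assumes l: "0 < l" "l < 1"
  shows "\<exists>S. is_invariant_set l S"
proof -
  define F where "F = (\<lambda>S. \<Union>i\<in>digits. sim_map l i ` S)"
  define K where "K = (\<lambda>n. (F ^^ n) triangle)"
  have K0: "K 0 = triangle" and KS: "K (Suc n) = F (K n)" for n
    by (simp_all add: K_def)
  have Fmono: "F A \<subseteq> F B" if "A \<subseteq> B" for A B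
    using that by (auto simp: F_def)
  have ne: "K n \<noteq> {}" for n
    by (induction n) (auto simp: K0 KS F_def digits_def triangle_def)
  have comp: "compact (K n)" for n
  proof (induction n)
    case 0
    show ?case by (simp add: K0 triangle_def finite_imp_compact_convex_hull)
  next
    case (Suc n)
    have "continuous_on (K n) (sim_map l i)" for i
      unfolding sim_map_def by (intro continuous_intros)
    then show ?case
      using Suc by (auto simp: KS F_def digits_def intro!: compact_Un compact_continuous_image)
  qed
  have dec1: "K (Suc n) \<subseteq> K n" for n
  proof (induction n)
    case 0
    show ?case using sim_map_triangle[OF l] unfolding KS K0 F_def by blast
  next
    case (Suc n)
    then show ?case using Fmono KS by metis
  qed
  have dec: "K n \<subseteq> K m" if "m \<le> n" for m n
    using lift_Suc_antimono_le[of K, OF dec1 that] .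
  define S where "S = (\<Inter>n. K n)"
  have "S \<noteq> {}"
    unfolding S_def by (rule compact_nest) (use comp ne dec in auto)
  moreover have "compact S"
    unfolding S_def using comp by (intro compact_Inter) auto
  moreover have "S = F S"
  proof
    show "F S \<subseteq> S"
    proof -
      have "F S \<subseteq> K n" for n
        using Fmono[of S "K n"] dec1[of n] KS[of n] by (auto simp: S_def)
      then show ?thesis by (auto simp: S_def)
    qed
    show "S \<subseteq> F S"
    proof
      fix x assume x: "x \<in> S"
      show "x \<in> F S"
      proof (rule ccontr)
        assume "x \<notin> F S"
        have "\<exists>n. x \<notin> sim_map l i ` K n" if "i \<in> digits" for i
        proof (rule ccontr)
          assume "\<not> (\<exists>n. x \<notin> sim_map l i ` K n)"
          then have "x \<in> (\<Inter>n. sim_map l i ` K n)" by blast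
          also have "\<dots> = sim_map l i ` S"
            unfolding S_def using inj_sim_map[OF l(1), of i] by (subst image_INT[of _ UNIV]) auto
          finally show False using \<open>x \<notin> F S\<close> that by (auto simp: F_def)
        qed
        then obtain N where N: "\<And>i. i \<in> digits \<Longrightarrow> x \<notin> sim_map l i ` K (N i)" by metis
        have "x \<in> K (Suc (N 0 + N 1 + N 2))" using x by (auto simp: S_def)
        then obtain i where i: "i \<in> digits" "x \<in> sim_map l i ` K (N 0 + N 1 + N 2)"
          unfolding KS F_def by blast
        have "N i \<le> N 0 + N 1 + N 2" using i(1) by (auto simp: digits_def)
        then show False using N[OF i(1)] i(2) dec by blast
      qed
    qed
  qed
  ultimately show ?thesis unfolding is_invariant_set_def F_def by blast
qed

lemma ex1_invariant_set:
  assumes "0 < l" "l < 1"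
  shows "\<exists>!S. is_invariant_set l S"
  using ex_invariant_set[OF assms] invariant_set_le[OF assms] by blast

end

theory Submission
  imports Defs
begin

text \<open>
  Write \<open>S\<close> for the invariant set and \<open>f\<^sub>i\<close> for \<open>sim_map \<omega> i\<close>. Since the maps are injective, the
  identity for a word follows letter by letter from the identity for single letters, and there
  the only real content is \<open>f\<^sub>i(\<Delta>) \<inter> S \<subseteq> f\<^sub>i(S)\<close>. Let \<open>h\<^sub>i\<close> be the barycentric coordinate belonging
  to the vertex \<open>p\<^sub>i\<close>; the points of \<open>f\<^sub>i(\<Delta>)\<close> satisfy \<open>h\<^sub>i \<ge> 1 - \<omega>\<close>. So the task is to show that
  every point of \<open>T = {x \<in> S. h\<^sub>i x \<ge> 1 - \<omega>}\<close> lies in \<open>f\<^sub>i(S)\<close>, or in other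
  words has an address \<open>x = f\<^sub>a f\<^sub>b f\<^sub>c \<dots>\<close> that starts with the digit \<open>a = i\<close>.

  Multiplied by \<open>1 - \<omega>\<close>, the multinacci equation becomes \<open>2\<omega> = 1 + \<omega>\<^bsup>m+1\<^esup>\<close>, and this yields
  \<open>f\<^sub>d f\<^sub>i\<^bsup>m\<^esup> = f\<^sub>i f\<^sub>d\<^bsup>m\<^esup>\<close> (\<open>sim_map_exchange\<close>): a digit \<open>d\<close> followed by \<open>m\<close> digits \<open>i\<close> may be traded for
  an \<open>i\<close> followed by \<open>m\<close> digits \<open>d\<close>. Now let \<open>x \<in> T\<close> have an address starting with some \<open>d \<noteq> i\<close>.
  For \<open>h\<^sub>i x\<close> to be as large as \<open>1 - \<omega>\<close> the following \<open>m - 1\<close> digits must all be \<open>i\<close>, because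
  \<open>\<omega> + \<omega>\<^sup>2 \<le> 1\<close>. The single borderline case is \<open>m = 2\<close> with \<open>x = f\<^sub>d f\<^sub>e p\<^sub>i\<close>, \<open>e \<noteq> i\<close>, and there the
  exchange, applied to \<open>p\<^sub>i = f\<^sub>i f\<^sub>i p\<^sub>i\<close>, produces an address of the desired kind
  (\<open>address_begins_with_run\<close>). Thus \<open>x = f\<^sub>d f\<^sub>i\<^bsup>m-1\<^esup> y\<close> with \<open>y \<in> S\<close>, and comparing coordinates
  gives \<open>y \<in> T\<close>.

  If \<open>y\<close> had an address starting with \<open>i\<close>, the exchange would finish the proof; but the same
  question for \<open>y\<close> may lead on to a third point, and so on forever. The regress is harmless since
  each step contracts: the exchange turns a point of \<open>f\<^sub>i(S)\<close> near \<open>y\<close> into a point of \<open>f\<^sub>i(S)\<close> near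
  \<open>x\<close>, whence \<open>dist(x, f\<^sub>i S) \<le> \<omega>\<^bsup>m\<^esup> dist(y, f\<^sub>i S)\<close>. At a point of the compact set \<open>T\<close> where the
  distance to \<open>f\<^sub>i(S)\<close> is maximal this forces the distance to be \<open>0\<close>. This maximum principle,
  \<open>nonpos_if_contracting\<close>, also yields the elementary facts about \<open>S\<close> that are needed.
\<close>

section \<open>A maximum principle and the basic geometry of the invariant set\<close>

text \<open>At a maximum point of \<open>g\<close> the hypothesis reads \<open>Max \<le> c * Max\<close> with \<open>c < 1\<close>.\<close>

lemma nonpos_if_contracting:
  fixes A :: "'a::topological_space set" and g :: "'a \<Rightarrow> real"
  assumes "compact A" "continuous_on A g" "0 \<le> c" "c < 1"
    and step: "\<And>x. x \<in> A \<Longrightarrow> \<exists>y\<in>A. g x \<le> c * g y"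
    and "x \<in> A"
  shows "g x \<le> 0"
proof -
  obtain a where a: "a \<in> A" "\<And>y. y \<in> A \<Longrightarrow> g y \<le> g a"
    using continuous_attains_sup[OF assms(1) _ assms(2)] \<open>x \<in> A\<close> by blast
  obtain y where "y \<in> A" "g a \<le> c * g y" using step[OF a(1)] by blast
  then have "g a \<le> c * g a"
    using mult_left_mono[OF a(2)[of y] \<open>0 \<le> c\<close>] by linarith
  then have "(1 - c) * g a \<le> 0" by (simp add: algebra_simps)
  then have "g a \<le> 0" using \<open>c < 1\<close> by (simp add: mult_le_0_iff)
  then show ?thesis using a(2)[OF \<open>x \<in> A\<close>] by linarith
qed

lemma inner_vert:
  assumes "i \<in> digits" "k \<in> digits"
  shows "vert i \<bullet> vert k = (if i = k then 4 / 9 else - 2 / 9)"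
proof -
  have angle: "2 * pi * real 2 / 3 = 2 * (2 * pi / 3)" by simp
  have v2: "vert 2 = vector [- 1 / 3, - sqrt 3 / 3]"
    unfolding vert_def angle cos_double sin_double cos_120 sin_120
    by (simp add: vec_eq_iff forall_2 power_divide)
  have v1: "vert 1 = vector [- 1 / 3, sqrt 3 / 3]" and v0: "vert 0 = vector [2 / 3, 0]"
    by (simp_all add: vert_def vec_eq_iff forall_2 cos_120 sin_120)
  show ?thesis
    using assms v1 by (auto simp: digits_def v0 v2 inner_vec_def sum_2)
qed

text \<open>The barycentric coordinate of \<open>x\<close> with respect to the vertex \<open>vert i\<close>: the affine function
  with value \<open>1\<close> there and \<open>0\<close> at the two other vertices.\<close>

definition bary :: "nat \<Rightarrow> real ^ 2 \<Rightarrow> real" where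
  "bary i x = 3 / 2 * (vert i \<bullet> x) + 1 / 3"

lemma bary_sim_map:
  assumes "i \<in> digits" "k \<in> digits"
  shows "bary i (sim_map l k x) = l * bary i x + (if i = k then 1 - l else 0)"
  using inner_vert[OF assms] by (auto simp: bary_def sim_map_def inner_simps algebra_simps)

lemma continuous_on_bary [continuous_intros]: "continuous_on A (bary i)"
  unfolding bary_def by (intro continuous_intros)

lemma bary_triangle_nonneg:
  assumes i: "i \<in> digits" and x: "x \<in> triangle"
  shows "0 \<le> bary i x"
proof -
  obtain u v w where uvw: "0 \<le> u" "0 \<le> v" "0 \<le> w" "u + v + w = 1"
    and x_eq: "x = u *\<^sub>R vert 0 + v *\<^sub>R vert 1 + w *\<^sub>R vert 2"
    using x by (auto simp: triangle_def convex_hull_3)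
  have "0 \<in> digits" "1 \<in> digits" "2 \<in> digits" by (auto simp: digits_def)
  then have "bary i x = 3 / 2 * (u * (if i = 0 then 4 / 9 else - 2 / 9)
      + v * (if i = 1 then 4 / 9 else - 2 / 9) + w * (if i = 2 then 4 / 9 else - 2 / 9)) + 1 / 3"
    using i by (simp add: bary_def x_eq inner_simps inner_vert)
  then show ?thesis using i uvw by (auto simp: digits_def field_simps)
qed

lemma invariant_set_image:
  assumes "is_invariant_set l S" "i \<in> digits" "x \<in> S"
  shows "sim_map l i x \<in> S"
  using assms by (auto simp: is_invariant_set_def)

lemma invariant_set_preimage:
  assumes "is_invariant_set l S" "x \<in> S"
  obtains i y where "i \<in> digits" "y \<in> S" "x = sim_map l i y"
  using assms unfolding is_invariant_set_def by blast

lemma dist_sim_map_power: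
  assumes "0 < l"
  shows "dist ((sim_map l i ^^ n) x) ((sim_map l i ^^ n) y) = l ^ n * dist x y"
  by (induction n) (simp_all add: dist_sim_map[OF assms])

lemma sim_map_power:
  "(sim_map l i ^^ n) x = l ^ n *\<^sub>R x + (1 - l ^ n) *\<^sub>R vert i"
proof (induction n)
  case (Suc n)
  then have "(sim_map l i ^^ Suc n) x = sim_map l i (l ^ n *\<^sub>R x + (1 - l ^ n) *\<^sub>R vert i)"
    by simp
  also have "\<dots> = l ^ Suc n *\<^sub>R x + (1 - l ^ Suc n) *\<^sub>R vert i"
    by (simp add: sim_map_def algebra_simps)
  finally show ?case .
qed simp

lemma bary_sim_map_power:
  assumes "i \<in> digits"
  shows "bary i ((sim_map l i ^^ n) x) = 1 - l ^ n * (1 - bary i x)"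
proof (induction n)
  case (Suc n)
  have "bary i ((sim_map l i ^^ Suc n) x) = l * (1 - l ^ n * (1 - bary i x)) + (1 - l)"
    using Suc by (simp add: bary_sim_map[OF assms assms])
  then show ?case by (simp add: algebra_simps)
qed simp

lemma sim_map_power_invariant:
  assumes "is_invariant_set l S" "i \<in> digits" "x \<in> S"
  shows "(sim_map l i ^^ n) x \<in> S"
  by (induction n) (simp_all add: assms invariant_set_image)

text \<open>A point of \<open>S\<close> is at most \<open>l\<close> times as far from the triangle as one of its preimages in
  \<open>S\<close>, so the maximum principle applies to that distance.\<close>

lemma invariant_set_subset_triangle:
  assumes l: "0 < l" "l < 1" and S: "is_invariant_set l S"
  shows "S \<subseteq> triangle"
proof
  fix x assume x: "x \<in> S"
  have tri: "closed triangle" "triangle \<noteq> {}"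
    by (simp_all add: triangle_def finite_imp_compact_convex_hull compact_imp_closed)
  have "infdist x triangle \<le> 0"
  proof (rule nonpos_if_contracting[where g = "\<lambda>x. infdist x triangle" and c = l, OF _ _ _ _ _ x])
    fix z assume "z \<in> S"
    then obtain i y where i: "i \<in> digits" and y: "y \<in> S" and z: "z = sim_map l i y"
      using invariant_set_preimage[OF S] by blast
    obtain b where b: "b \<in> triangle" "infdist y triangle = dist y b"
      using infdist_attains_inf[OF tri] by metis
    have "sim_map l i b \<in> triangle" using sim_map_triangle[OF l i] b(1) by blast
    then have "infdist z triangle \<le> l * infdist y triangle"
      using infdist_le[of "sim_map l i b" triangle z] dist_sim_map[OF l(1)] z b(2) by simp
    then show "\<exists>y\<in>S. infdist z triangle \<le> l * infdist y triangle" using y by blast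
  qed (use S l in \<open>auto simp: is_invariant_set_def intro: continuous_intros\<close>)
  then show "x \<in> triangle"
    using in_closed_iff_infdist_zero[OF tri] infdist_nonneg[of x triangle] by (metis order_antisym)
qed

lemma bary_invariant_set_le_1:
  assumes l: "0 < l" "l < 1" and S: "is_invariant_set l S" and i: "i \<in> digits" and x: "x \<in> S"
  shows "bary i x \<le> 1"
proof -
  have "bary i x - 1 \<le> 0"
  proof (rule nonpos_if_contracting[where g = "\<lambda>x. bary i x - 1" and c = l, OF _ _ _ _ _ x])
    fix z assume "z \<in> S"
    then obtain k y where k: "k \<in> digits" and y: "y \<in> S" and z: "z = sim_map l k y"
      using invariant_set_preimage[OF S] by blast
    have "bary i z - 1 \<le> l * (bary i y - 1)"
      using l by (auto simp: z bary_sim_map[OF i k] algebra_simps)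
    then show "\<exists>y\<in>S. bary i z - 1 \<le> l * (bary i y - 1)" using y by blast
  qed (use S l in \<open>auto simp: is_invariant_set_def intro!: continuous_intros\<close>)
  then show ?thesis by simp
qed

text \<open>The points of \<open>S\<close> with \<open>bary i = 1\<close> form a compact set whose members all have a preimage under
  \<open>sim_map l i\<close> in that same set; their distance to the fixed point \<open>vert i\<close> must then vanish.\<close>

lemma invariant_set_bary_eq_1:
  assumes l: "0 < l" "l < 1" and S: "is_invariant_set l S" and i: "i \<in> digits"
    and x: "x \<in> S" "bary i x = 1"
  shows "x = vert i"
proof -
  define E where "E = S \<inter> {x. bary i x = 1}"
  have "compact S" using S by (simp add: is_invariant_set_def)
  then have compactE: "compact E" unfolding E_def
    by (intro compact_Int_closed closed_Collect_eq continuous_intros)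
  have "dist x (vert i) \<le> 0"
  proof (rule nonpos_if_contracting[where g = "\<lambda>x. dist x (vert i)" and c = l and A = E])
    fix z assume z: "z \<in> E"
    obtain k y where k: "k \<in> digits" and y: "y \<in> S" and z_eq: "z = sim_map l k y"
      using invariant_set_preimage[OF S] z by (auto simp: E_def)
    have eq: "l * bary i y + (if i = k then 1 - l else 0) = 1"
      using z bary_sim_map[OF i k, of l y] z_eq by (simp add: E_def)
    have "l * bary i y \<le> l"
      using bary_invariant_set_le_1[OF l S i y] l by simp
    then have "i = k" using eq l by (metis add.right_neutral not_less)
    then have "l * bary i y = l * 1" using eq by simp
    then have "y \<in> E" using y l(1) by (simp add: E_def)
    moreover have "sim_map l i (vert i) = vert i" by (simp add: sim_map_def algebra_simps)
    then have "dist z (vert i) = l * dist y (vert i)"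
      using dist_sim_map[OF l(1), of i y "vert i"] z_eq \<open>i = k\<close> by simp
    ultimately show "\<exists>y\<in>E. dist z (vert i) \<le> l * dist y (vert i)" by auto
  qed (use compactE l x in \<open>auto simp: E_def intro!: continuous_intros\<close>)
  then show ?thesis by simp
qed

section \<open>The multinacci number and the exchange of digits\<close>

lemma multinacci_eq:
  assumes "m \<ge> 1"
  shows "0 < multinacci m" "(\<Sum>j = 1..m. multinacci m ^ j) = 1"
  using theI'[OF ex1_multinacci[OF assms]] by (simp_all add: multinacci_def)

lemma multinacci_less_1:
  assumes "m \<ge> 2"
  shows "multinacci m < 1"
proof (rule ccontr)
  let ?w = "multinacci m"
  assume "\<not> ?w < 1"
  then have "(\<Sum>j = 1..m. 1) \<le> (\<Sum>j = 1..m. ?w ^ j)"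
    by (intro sum_mono) (simp add: one_le_power)
  then show False using multinacci_eq[of m] assms by simp
qed

lemma multinacci_power:
  assumes "m \<ge> 1"
  shows "multinacci m ^ (m + 1) = 2 * multinacci m - 1"
proof -
  let ?w = "multinacci m"
  have "(1 - ?w) * (\<Sum>j = 1..m. ?w ^ j) = ?w - ?w ^ (m + 1)"
    using assms by (simp add: sum_gp_multiplied)
  then show ?thesis using multinacci_eq[OF assms] by simp
qed

lemma multinacci_add_square_le_1:
  assumes "m \<ge> 2"
  shows "multinacci m + multinacci m ^ 2 \<le> 1"
    and "multinacci m + multinacci m ^ 2 = 1 \<Longrightarrow> m = 2"
proof -
  let ?w = "multinacci m"
  have w: "0 < ?w" "(\<Sum>j = 1..m. ?w ^ j) = 1" using multinacci_eq[of m] assms by simp_all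
  obtain k where k: "m = 2 + k" using assms le_iff_add by blast
  have "(\<Sum>j = 1..m. v ^ j) = (\<Sum>j = 1..2. v ^ j) + (\<Sum>j = 2 + 1..m. v ^ j)" for v :: real
    unfolding k by (rule sum.ub_add_nat) simp
  then have split: "?w + ?w ^ 2 + (\<Sum>j = 3..m. ?w ^ j) = 1"
    using w by (simp add: numeral_eq_Suc)
  moreover have "(\<Sum>j = 3..m. ?w ^ j) \<ge> 0" using w by (intro sum_nonneg) simp
  ultimately show "?w + ?w ^ 2 \<le> 1" by linarith
  show "m = 2" if "?w + ?w ^ 2 = 1"
  proof (rule ccontr)
    assume "m \<noteq> 2"
    then have "(\<Sum>j = 3..m. ?w ^ j) > 0" using w assms by (intro sum_pos) auto
    then show False using split that by linarith
  qed
qed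

text \<open>Both sides have linear part \<open>\<omega>\<^bsup>m+1\<^esup>\<close>; the translation parts are
  \<open>(1 - \<omega>) p\<^sub>d + (\<omega> - \<omega>\<^bsup>m+1\<^esup>) p\<^sub>i\<close> and the same with \<open>d\<close> and \<open>i\<close> swapped, and the two coefficients
  coincide precisely because of the multinacci equation.\<close>

lemma sim_map_exchange:
  assumes "m \<ge> 1"
  defines "w \<equiv> multinacci m"
  shows "sim_map w d ((sim_map w i ^^ m) x) = sim_map w i ((sim_map w d ^^ m) x)"
proof -
  have "w * (1 - w ^ m) = 1 - w"
    using multinacci_power[OF assms(1)] by (simp add: w_def algebra_simps)
  then show ?thesis by (simp add: sim_map_def sim_map_power scaleR_add_right add_ac)
qed

section \<open>Addresses of points in a cell of level one\<close>

lemma invariant_set_run_or_break: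
  assumes S: "is_invariant_set l S" and "x \<in> S"
  shows "(\<exists>y\<in>S. x = (sim_map l i ^^ n) y) \<or>
    (\<exists>j<n. \<exists>e\<in>digits - {i}. \<exists>y\<in>S. x = (sim_map l i ^^ j) (sim_map l e y))"
proof (induction n)
  case 0
  then show ?case using \<open>x \<in> S\<close> by auto
next
  case (Suc n)
  show ?case
  proof (cases "\<exists>y\<in>S. x = (sim_map l i ^^ n) y")
    case True
    then obtain y where y: "y \<in> S" "x = (sim_map l i ^^ n) y" by blast
    obtain e z where e: "e \<in> digits" "z \<in> S" "y = sim_map l e z"
      using invariant_set_preimage[OF S y(1)] by blast
    show ?thesis
    proof (cases "e = i")
      case True
      then have "x = (sim_map l i ^^ Suc n) z" using y e by (simp add: funpow_swap1)
      then show ?thesis using e by blast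
    next
      case False
      then show ?thesis using y e by blast
    qed
  next
    case False
    then show ?thesis using Suc less_SucI by blast
  qed
qed

text \<open>Suppose the digit \<open>d\<close> is followed by only \<open>j \<le> m - 2\<close> digits \<open>i\<close>, then by \<open>e \<noteq> i\<close> and a tail
  with value \<open>z\<close>. The coordinate of the point is \<open>\<omega> - \<omega>\<^bsup>j+1\<^esup> (1 - \<omega> h\<^sub>i z)\<close>, so it can reach
  \<open>1 - \<omega>\<close> only if \<open>1 - \<omega> h\<^sub>i z \<le> \<omega>\<^bsup>m-j\<^esup> \<le> \<omega>\<^sup>2\<close>. As \<open>h\<^sub>i z \<le> 1\<close> and \<open>\<omega> + \<omega>\<^sup>2 \<le> 1\<close>, equality
  holds throughout: \<open>m = 2\<close> and \<open>z\<close> is the vertex \<open>p\<^sub>i\<close>.\<close>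

lemma address_begins_with_run:
  assumes m: "m \<ge> 2"
  defines "w \<equiv> multinacci m"
  assumes S: "is_invariant_set w S"
    and i: "i \<in> digits" and x: "x \<in> S" "x \<notin> sim_map w i ` S" "bary i x \<ge> 1 - w"
  obtains d y where "d \<in> digits - {i}" "y \<in> S" "x = sim_map w d ((sim_map w i ^^ (m - 1)) y)"
proof -
  have w: "0 < w" "w < 1"
    using multinacci_eq[of m] multinacci_less_1[OF m] m by (simp_all add: w_def)
  obtain d s where d: "d \<in> digits" and s: "s \<in> S" and x_eq: "x = sim_map w d s"
    using invariant_set_preimage[OF S x(1)] by blast
  have "d \<noteq> i" using x(2) s x_eq by blast
  consider y where "y \<in> S" "s = (sim_map w i ^^ (m - 1)) y"
    | j e z where "j < m - 1" "e \<in> digits - {i}" "z \<in> S" "s = (sim_map w i ^^ j) (sim_map w e z)"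
    using invariant_set_run_or_break[OF S s, of "m - 1" i] by blast
  then show thesis
  proof cases
    case 1
    then show thesis using that[of d y] d \<open>d \<noteq> i\<close> x_eq by blast
  next
    case 2
    have hz: "bary i z \<le> 1" using bary_invariant_set_le_1[OF w S i 2(3)] .
    have "bary i x = w * (1 - w ^ j * (1 - w * bary i z))"
      using 2(2) d i \<open>d \<noteq> i\<close> by (auto simp: x_eq 2(4) bary_sim_map bary_sim_map_power)
    then have "w ^ (j + 1) * (1 - w * bary i z) \<le> 2 * w - 1"
      using x(3) by (simp add: algebra_simps)
    also have "\<dots> = w ^ (m + 1)"
      using multinacci_power[of m] m by (simp add: w_def)
    also have "\<dots> = w ^ (j + 1) * w ^ (m - j)"
      using 2(1) by (simp flip: power_add)
    finally have "1 - w * bary i z \<le> w ^ (m - j)"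
      using w by simp
    also have "\<dots> \<le> w ^ 2"
      using 2(1) w by (intro power_decreasing) auto
    finally have lower: "1 - w * bary i z \<le> w ^ 2" .
    have upper: "w * bary i z \<le> w * 1" using hz w by (intro mult_left_mono) auto
    have "w + w ^ 2 \<le> 1" using multinacci_add_square_le_1(1)[OF m] by (simp add: w_def)
    then have "w + w ^ 2 = 1" and "w * bary i z = w * 1"
      using lower upper by linarith+
    then have "m = 2" and "bary i z = 1"
      using multinacci_add_square_le_1(2)[OF m] w by (simp_all add: w_def)
    then have z: "z = vert i" using invariant_set_bary_eq_1[OF w S i 2(3)] by simp
    have "j = 0" using 2(1) \<open>m = 2\<close> by simp
    \<comment> \<open>The vertex is fixed by \<open>sim_map w i\<close>, so it may be regarded as a run of \<open>m\<close> digits \<open>i\<close>;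
      the exchange then moves one digit \<open>i\<close> to the place directly after \<open>d\<close>, which is all that
      is required when \<open>m - 1 = 1\<close>.\<close>
    have "z = (sim_map w i ^^ m) z" by (simp add: z sim_map_power algebra_simps)
    then have "sim_map w e z = sim_map w i ((sim_map w e ^^ m) z)"
      using sim_map_exchange[of m e i z] m by (simp add: w_def)
    then have "x = sim_map w d ((sim_map w i ^^ (m - 1)) ((sim_map w e ^^ m) z))"
      using \<open>j = 0\<close> \<open>m = 2\<close> 2(4) x_eq by simp
    moreover have "(sim_map w e ^^ m) z \<in> S"
      using 2(2,3) sim_map_power_invariant[OF S] by blast
    ultimately show thesis using that d \<open>d \<noteq> i\<close> by blast
  qed
qed

text \<open>The infinite rewriting of addresses is replaced by the maximum principle, applied to the
  distance from \<open>sim_map w i ` S\<close> on the compact set \<open>T\<close>.\<close>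

lemma mem_cell_if_bary_ge:
  assumes m: "m \<ge> 2"
  defines "w \<equiv> multinacci m"
  assumes S: "is_invariant_set w S"
    and i: "i \<in> digits" and x: "x \<in> S" "bary i x \<ge> 1 - w"
  shows "x \<in> sim_map w i ` S"
proof -
  have w: "0 < w" "w < 1"
    using multinacci_eq[of m] multinacci_less_1[OF m] m by (simp_all add: w_def)
  define T where "T = S \<inter> {x. 1 - w \<le> bary i x}"
  define C where "C = sim_map w i ` S"
  have "compact S" "S \<noteq> {}" using S by (simp_all add: is_invariant_set_def)
  have "compact T" unfolding T_def
    by (intro compact_Int_closed \<open>compact S\<close> closed_Collect_le continuous_intros)
  have "continuous_on S (sim_map w i)" unfolding sim_map_def by (intro continuous_intros)
  then have C: "closed C" "C \<noteq> {}"
    using \<open>compact S\<close> \<open>S \<noteq> {}\<close>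
    by (auto simp: C_def intro: compact_imp_closed compact_continuous_image)
  have "infdist x C \<le> 0"
  proof (rule nonpos_if_contracting[where g = "\<lambda>x. infdist x C" and c = "w ^ m" and A = T])
    fix z assume z: "z \<in> T"
    show "\<exists>y\<in>T. infdist z C \<le> w ^ m * infdist y C"
    proof (cases "z \<in> C")
      case True
      then show ?thesis using z w by (intro bexI[of _ z]) (simp_all add: infdist_zero)
    next
      case False
      obtain d y where d: "d \<in> digits - {i}" and y: "y \<in> S"
        and z_eq: "z = sim_map w d ((sim_map w i ^^ (m - 1)) y)"
        using address_begins_with_run[OF m S[unfolded w_def] i] z False
        by (auto simp: T_def C_def w_def)
      have pow: "w * w ^ (m - 1) = w ^ m" using m by (simp add: power_eq_if)
      have "bary i z = w * (1 - w ^ (m - 1) * (1 - bary i y))"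
        using d i by (auto simp: z_eq bary_sim_map bary_sim_map_power)
      also have "\<dots> = w - w * w ^ (m - 1) * (1 - bary i y)" by (simp add: algebra_simps)
      also have "\<dots> = w - w ^ m * (1 - bary i y)" unfolding pow ..
      finally have "w ^ m * (1 - bary i y) \<le> 2 * w - 1" using z by (simp add: T_def)
      also have "\<dots> = w ^ m * w" using multinacci_power[of m] m by (simp add: w_def mult.commute)
      \<comment> \<open>The bound on \<open>bary i z\<close> passes to \<open>y\<close> unchanged, again because \<open>2\<omega> - 1 = \<omega>\<^bsup>m+1\<^esup>\<close>.\<close>
      finally have "1 - bary i y \<le> w" using w by simp
      then have yT: "y \<in> T" using y by (simp add: T_def)
      obtain b where b: "b \<in> C" "infdist y C = dist y b"
        using infdist_attains_inf[OF C] by metis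
      obtain s where s: "s \<in> S" "b = sim_map w i s" using b(1) by (auto simp: C_def)
      \<comment> \<open>The map that sends \<open>y\<close> to \<open>z\<close> sends \<open>b\<close> to a point whose address starts with \<open>d\<close> and
        \<open>m\<close> digits \<open>i\<close>, which the exchange puts into \<open>C\<close>.\<close>
      let ?b' = "sim_map w d ((sim_map w i ^^ (m - 1)) b)"
      have "(sim_map w i ^^ (m - 1)) b = (sim_map w i ^^ m) s"
        using m s(2) funpow_Suc_right[of "m - 1" "sim_map w i"] by simp
      then have "?b' = sim_map w i ((sim_map w d ^^ m) s)"
        using sim_map_exchange[of m d i s] m by (simp add: w_def)
      then have "?b' \<in> C" using sim_map_power_invariant[OF S _ s(1)] d by (auto simp: C_def)
      then have "infdist z C \<le> dist z ?b'" by (rule infdist_le)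
      also have "\<dots> = w * w ^ (m - 1) * infdist y C"
        by (simp add: z_eq dist_sim_map[OF w(1)] dist_sim_map_power[OF w(1)] b(2))
      also have "\<dots> = w ^ m * infdist y C" unfolding pow ..
      finally show ?thesis using yT by blast
    qed
  qed (use \<open>compact T\<close> w m x in
      \<open>auto simp: T_def power_less_one_iff intro!: continuous_intros\<close>)
  then show ?thesis
    using in_closed_iff_infdist_zero[OF C] infdist_nonneg[of x C] unfolding C_def
    by (metis order_antisym)
qed

section \<open>Total self-similarity\<close>

text \<open>Cells of higher level lie in cells of level one, and inside a cell of level one the identity
  is the image under the injective map \<open>sim_map l i\<close> of the identity for a word shorter by one
  letter.\<close>

lemma totally_self_similar_if_level_one:
  assumes l: "0 < l"
    and sub: "invariant_set l \<subseteq> triangle"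
    and tri: "\<And>i. i \<in> digits \<Longrightarrow> sim_map l i ` triangle \<subseteq> triangle"
    and level_one: "\<And>i. i \<in> digits \<Longrightarrow>
      sim_map l i ` invariant_set l = sim_map l i ` triangle \<inter> invariant_set l"
  shows "totally_self_similar l"
proof -
  let ?S = "invariant_set l"
  have "word_map l eps ` ?S = word_map l eps ` triangle \<inter> ?S \<and>
      word_map l eps ` triangle \<subseteq> triangle" if "set eps \<subseteq> digits" for eps
    using that
  proof (induction eps)
    case Nil
    then show ?case using sub by (auto simp: word_map_def)
  next
    case (Cons i eps)
    let ?f = "sim_map l i"
    have i: "i \<in> digits" and IH: "word_map l eps ` ?S = word_map l eps ` triangle \<inter> ?S"
      "word_map l eps ` triangle \<subseteq> triangle"
      using Cons by auto
    have word: "word_map l (i # eps) ` A = ?f ` word_map l eps ` A" for A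
      by (simp add: word_map_def image_comp)
    have "?f ` word_map l eps ` ?S = ?f ` word_map l eps ` triangle \<inter> ?f ` ?S"
      unfolding IH(1) using inj_sim_map[OF l] by (rule image_Int)
    also have "\<dots> = ?f ` word_map l eps ` triangle \<inter> ?S"
      using level_one[OF i] IH(2) by blast
    finally show ?case using IH(2) tri[OF i] unfolding word by blast
  qed
  then show ?thesis by (auto simp: totally_self_similar_def)
qed

theorem theorem3p3:
  fixes m :: nat
  assumes "m \<ge> 2"
  shows "totally_self_similar (multinacci m)"
proof -
  let ?w = "multinacci m"
  have w: "0 < ?w" "?w < 1"
    using multinacci_eq[of m] multinacci_less_1 assms by simp_all
  have S: "is_invariant_set ?w (invariant_set ?w)"
    using theI'[OF ex1_invariant_set[OF w]] by (simp add: invariant_set_def)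
  note sub = invariant_set_subset_triangle[OF w S]
  show ?thesis
  proof (rule totally_self_similar_if_level_one[OF w(1) sub sim_map_triangle[OF w]])
    fix i assume i: "i \<in> digits"
    show "sim_map ?w i ` invariant_set ?w = sim_map ?w i ` triangle \<inter> invariant_set ?w"
    proof (intro equalityI subsetI)
      fix x assume "x \<in> sim_map ?w i ` triangle \<inter> invariant_set ?w"
      then obtain t where t: "t \<in> triangle" "x = sim_map ?w i t" and x: "x \<in> invariant_set ?w"
        by blast
      have "1 - ?w \<le> bary i x"
        using bary_triangle_nonneg[OF i t(1)] w by (simp add: t(2) bary_sim_map[OF i i])
      then show "x \<in> sim_map ?w i ` invariant_set ?w"
        using mem_cell_if_bary_ge[OF assms S i x] by simp
    qed (use sub invariant_set_image[OF S i] in blast)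
  qed
qed

end
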